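(* Let $\Gamma$ be a countable group and consider a measure preserving, ergodic action of $\Gamma$ on a standard probability space $(X,\mu)$ with associated equivalence relation $F=E^X_\Gamma$. Let $E\subseteq F$ be a subequivalence relation. If $\varphi^0_E=\inf_{\gamma\in\Gamma}\varphi_E(\gamma)>\frac34$, then there is an $E$-invariant Borel set $A$ with $E|A=F|A$ such that $\mu(A)\ge 4\varphi^0_E-3$.
   Context: Everything is modulo null sets; equivalence relations are Borel. $E^X_\Gamma$ is the orbit equivalence relation; $\varphi_E(\gamma)=\mu(\{x:\gamma\cdot x\,E\,x\})$; $E|A=E\cap A^2$. *)

theory Defs
  imports "HOL-Probability.Probability" "HOL-Algebra.Group_Action"
begin

definition standard_borel :: "'a measure \<Rightarrow> bool" where
  "standard_borel M \<longleftrightarrow>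
     (\<exists>T. completely_metrizable_space T \<and> second_countable T \<and> topspace T = space M \<and>
          sets M = sigma_sets (topspace T) {U. openin T U})"

definition standard_prob_space :: "'a measure \<Rightarrow> bool" where
  "standard_prob_space M \<longleftrightarrow> standard_borel M \<and> prob_space M"

definition measure_preserving_action ::
    "('g, 'b) monoid_scheme \<Rightarrow> 'a measure \<Rightarrow> ('g \<Rightarrow> 'a \<Rightarrow> 'a) \<Rightarrow> bool" where
  "measure_preserving_action G M \<phi> \<longleftrightarrow>
     group_action G (space M) \<phi> \<and>
     (\<forall>g\<in>carrier G. \<phi> g \<in> measurable M M \<and> distr M M (\<phi> g) = M)"

definition ergodic_action ::
    "('g, 'b) monoid_scheme \<Rightarrow> 'a measure \<Rightarrow> ('g \<Rightarrow> 'a \<Rightarrow> 'a) \<Rightarrow> bool" where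
  "ergodic_action G M \<phi> \<longleftrightarrow>
     (\<forall>A\<in>sets M. (\<forall>g\<in>carrier G. \<phi> g ` A = A) \<longrightarrow> measure M A = 0 \<or> measure M A = 1)"

definition orbit_rel ::
    "('g, 'b) monoid_scheme \<Rightarrow> 'a measure \<Rightarrow> ('g \<Rightarrow> 'a \<Rightarrow> 'a) \<Rightarrow> ('a \<times> 'a) set" where
  "orbit_rel G M \<phi> = {(x, y). x \<in> space M \<and> y \<in> orbit G \<phi> x}"

definition borel_equiv :: "'a measure \<Rightarrow> ('a \<times> 'a) set \<Rightarrow> bool" where
  "borel_equiv M E \<longleftrightarrow> equiv (space M) E \<and> E \<in> sets (M \<Otimes>\<^sub>M M)"

text \<open>
  Relations on the space are compared modulo null sets of points: a property holds
  modulo null sets if it holds after removing a null set from the space. (The product measure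
  would be the wrong notion: an equivalence relation with countable classes is typically
  null for it.)
\<close>

definition ae_subrel :: "'a measure \<Rightarrow> ('a \<times> 'a) set \<Rightarrow> ('a \<times> 'a) set \<Rightarrow> bool" where
  "ae_subrel M E F \<longleftrightarrow>
     (\<exists>N\<in>null_sets M. \<forall>x\<in>space M - N. \<forall>y\<in>space M - N. (x, y) \<in> E \<longrightarrow> (x, y) \<in> F)"

definition ae_eq_rel :: "'a measure \<Rightarrow> ('a \<times> 'a) set \<Rightarrow> ('a \<times> 'a) set \<Rightarrow> bool" where
  "ae_eq_rel M E F \<longleftrightarrow>
     (\<exists>N\<in>null_sets M. \<forall>x\<in>space M - N. \<forall>y\<in>space M - N. (x, y) \<in> E \<longleftrightarrow> (x, y) \<in> F)"

definition ae_invariant :: "'a measure \<Rightarrow> ('a \<times> 'a) set \<Rightarrow> 'a set \<Rightarrow> bool" where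
  "ae_invariant M E A \<longleftrightarrow>
     (\<exists>N\<in>null_sets M. \<forall>x\<in>space M - N. \<forall>y\<in>space M - N. (x, y) \<in> E \<longrightarrow> x \<in> A \<longrightarrow> y \<in> A)"

definition rel_restrict :: "('a \<times> 'a) set \<Rightarrow> 'a set \<Rightarrow> ('a \<times> 'a) set" where
  "rel_restrict E A = E \<inter> A \<times> A"

definition phi_rel ::
    "'a measure \<Rightarrow> ('g \<Rightarrow> 'a \<Rightarrow> 'a) \<Rightarrow> ('a \<times> 'a) set \<Rightarrow> 'g \<Rightarrow> real" where
  "phi_rel M \<phi> E g = measure M {x \<in> space M. (\<phi> g x, x) \<in> E}"

definition phi_rel_inf ::
    "('g, 'b) monoid_scheme \<Rightarrow> 'a measure \<Rightarrow> ('g \<Rightarrow> 'a \<Rightarrow> 'a) \<Rightarrow> ('a \<times> 'a) set \<Rightarrow> real" where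
  "phi_rel_inf G M \<phi> E = (INF g\<in>carrier G. phi_rel M \<phi> E g)"

end

theory Submission
  imports Defs
begin

text \<open>
  Attach to a point \<open>x\<close> the Hilbert space of square summable functions on the \<open>E\<close>-classes. A finitely
  supported probability weight \<open>p\<close> on \<open>\<Gamma>\<close> gives the vector field whose value at \<open>x\<close> assigns to each
  class the \<open>p\<close>-probability that \<open>a \<cdot> x\<close> lies in it. These fields are the convex combinations of
  the \<open>\<Gamma>\<close>-translates of the field that sends \<open>x\<close> to the Dirac mass at the class of \<open>x\<close>. The element of
  least norm in the closed convex hull of these translates is \<open>\<Gamma>\<close>-invariant: in the limit the mass of
  a class no longer depends on the base point in the orbit. Let \<open>f x\<close> be the limiting mass of the
  class of \<open>x\<close>. Then \<open>f\<close> is \<open>E\<close>-invariant, and since the masses of distinct classes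
  add up to at most 1, \<open>f x + f y \<le> 1\<close> whenever \<open>x\<close> and \<open>y\<close> lie in the same orbit but in different
  classes. Hence at most one class in each orbit meets \<open>A = {x. f x > 1/2}\<close>, so \<open>E\<close> and the orbit
  relation agree on \<open>A\<close>. Each weight gives its own class an average mass of at least \<open>\<phi>\<^sup>0 =
  phi_rel_inf \<Gamma> M \<phi> E\<close>, being an average of the numbers \<open>phi_rel M \<phi> E g\<close>; therefore
  \<open>\<phi>\<^sup>0 \<le> \<integral> f \<le> 1/2 + \<mu>(A)/2\<close>, and \<open>\<mu>(A) \<ge> 2\<phi>\<^sup>0 - 1 \<ge> 4\<phi>\<^sup>0 - 3\<close>.

  The Hilbert spaces are never built. The squared norm of a vector field is a
  quadratic form in its weight, called energy below, and two facts replace the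
  geometry: the parallelogram identity \<open>energy_parallelogram\<close>, which makes weights of nearly minimal
  energy nearly equal and nearly invariant, and \<open>class_weight_second_moment\<close>, by which the energy
  dominates the second moment of each single coordinate. Nearly minimal weights are chosen
  with geometrically small defects, so that all the limits exist almost everywhere.
\<close>

section \<open>Finitely supported weights\<close>

definition weighted_sum :: "('g \<Rightarrow> real) \<Rightarrow> ('g \<Rightarrow> real) \<Rightarrow> real" where
  "weighted_sum c f = (\<Sum>a | c a \<noteq> 0. c a * f a)"

definition fin_weights :: "'g set \<Rightarrow> ('g \<Rightarrow> real) set" where
  "fin_weights G = {c. finite {a. c a \<noteq> 0} \<and> {a. c a \<noteq> 0} \<subseteq> G}"

definition prob_weights :: "'g set \<Rightarrow> ('g \<Rightarrow> real) set" where
  "prob_weights G = {p \<in> fin_weights G. (\<forall>a. 0 \<le> p a) \<and> weighted_sum p (\<lambda>_. 1) = 1}"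

lemma weighted_sum_superset:
  assumes "finite S" "{a. c a \<noteq> 0} \<subseteq> S"
  shows "weighted_sum c f = (\<Sum>a\<in>S. c a * f a)"
  unfolding weighted_sum_def by (rule sum.mono_neutral_left) (use assms in auto)

lemma weighted_sum_cong:
  "(\<And>a. c a \<noteq> 0 \<Longrightarrow> f a = g a) \<Longrightarrow> weighted_sum c f = weighted_sum c g"
  unfolding weighted_sum_def by (rule sum.cong) auto

lemma fin_weights_lincomb:
  assumes "c \<in> fin_weights G" "d \<in> fin_weights G"
  shows "(\<lambda>a. s * c a + t * d a) \<in> fin_weights G"
proof -
  have "{a. s * c a + t * d a \<noteq> 0} \<subseteq> {a. c a \<noteq> 0} \<union> {a. d a \<noteq> 0}" by auto
  with assms show ?thesis
    unfolding fin_weights_def by (auto intro: finite_subset)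
qed

lemma weighted_sum_lincomb_left:
  assumes "c \<in> fin_weights G" "d \<in> fin_weights G"
  shows "weighted_sum (\<lambda>a. s * c a + t * d a) f = s * weighted_sum c f + t * weighted_sum d f"
proof -
  let ?S = "{a. c a \<noteq> 0} \<union> {a. d a \<noteq> 0}"
  have S: "finite ?S" using assms by (auto simp: fin_weights_def)
  have "weighted_sum (\<lambda>a. s * c a + t * d a) f = (\<Sum>a\<in>?S. (s * c a + t * d a) * f a)"
    by (rule weighted_sum_superset[OF S]) auto
  moreover have "weighted_sum c f = (\<Sum>a\<in>?S. c a * f a)"
    by (rule weighted_sum_superset[OF S]) auto
  moreover have "weighted_sum d f = (\<Sum>a\<in>?S. d a * f a)"
    by (rule weighted_sum_superset[OF S]) auto
  ultimately show ?thesis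
    by (simp add: algebra_simps sum.distrib sum_distrib_left)
qed

lemma weighted_sum_lincomb_right:
  "weighted_sum c (\<lambda>a. s * f a + t * g a) = s * weighted_sum c f + t * weighted_sum c g"
  unfolding weighted_sum_def by (simp add: algebra_simps sum.distrib sum_distrib_left)

lemma weighted_sum_mono:
  assumes "p \<in> prob_weights G" "\<And>a. a \<in> G \<Longrightarrow> f a \<le> g a"
  shows "weighted_sum p f \<le> weighted_sum p g"
  unfolding weighted_sum_def
  by (rule sum_mono) (use assms in \<open>auto simp: prob_weights_def fin_weights_def intro!: mult_left_mono\<close>)

lemma weighted_sum_const:
  "p \<in> prob_weights G \<Longrightarrow> weighted_sum p (\<lambda>_. s) = s"
  using weighted_sum_lincomb_right[of p s "\<lambda>_. 1" 0 "\<lambda>_. 1"] by (simp add: prob_weights_def)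

lemma prob_weights_midpoint:
  assumes "p \<in> prob_weights G" "q \<in> prob_weights G"
  shows "(\<lambda>a. 1/2 * p a + 1/2 * q a) \<in> prob_weights G"
proof -
  have f: "p \<in> fin_weights G" "q \<in> fin_weights G" using assms by (auto simp: prob_weights_def)
  show ?thesis
    using assms fin_weights_lincomb[OF f, of "1/2" "1/2"]
      weighted_sum_lincomb_left[OF f, of "1/2" "1/2" "\<lambda>_. 1"]
    by (auto simp: prob_weights_def)
qed

text \<open>
  Group the terms of the double sum by class: with \<open>w C\<close> the total weight of the indices that \<open>u\<close> sends
  into \<open>C\<close>, the right-hand side is the sum of the squares \<open>(w C)\<^sup>2\<close>, and the left-hand side is one of
  them, or zero if no index reaches the class of \<open>y\<close>. The weights may have
  any sign, which is what makes the bound applicable to differences of probability weights.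
\<close>

lemma square_class_weight_le:
  assumes E: "equiv A E" and c: "c \<in> fin_weights G" and u: "\<And>a. a \<in> G \<Longrightarrow> u a \<in> A" and y: "y \<in> A"
  shows "(weighted_sum c (\<lambda>a. indicator E (u a, y)))\<^sup>2
    \<le> weighted_sum c (\<lambda>a. weighted_sum c (\<lambda>b. indicator E (u a, u b)))"
proof -
  define S where "S = {a. c a \<noteq> 0}"
  define \<kappa> where "\<kappa> a = E `` {u a}" for a
  define w where "w C = (\<Sum>a\<in>{a\<in>S. \<kappa> a = C}. c a)" for C
  have S: "finite S" "\<And>a. a \<in> S \<Longrightarrow> u a \<in> A" using c u by (auto simp: S_def fin_weights_def)
  have iff: "(u a, z) \<in> E \<longleftrightarrow> \<kappa> a = E `` {z}" if "a \<in> S" "z \<in> A" for a z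
    using eq_equiv_class_iff[OF E] S(2) that unfolding \<kappa>_def by auto
  have ws: "weighted_sum c (\<lambda>a. indicator E (u a, z)) = w (E `` {z})" if "z \<in> A" for z
  proof -
    have "weighted_sum c (\<lambda>a. indicator E (u a, z)) = (\<Sum>a\<in>S. if \<kappa> a = E `` {z} then c a else 0)"
      unfolding weighted_sum_def S_def[symmetric]
      by (rule sum.cong) (use iff that in \<open>auto simp: indicator_def\<close>)
    also have "\<dots> = w (E `` {z})"
      unfolding w_def using S(1) by (simp add: sum.If_cases Int_def)
    finally show ?thesis .
  qed
  have sym: "(v, z) \<in> E \<longleftrightarrow> (z, v) \<in> E" for v z
    using E by (auto simp: equiv_def sym_def)
  have "weighted_sum c (\<lambda>a. weighted_sum c (\<lambda>b. indicator E (u a, u b)))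
      = (\<Sum>a\<in>S. c a * weighted_sum c (\<lambda>b. indicator E (u a, u b)))"
    by (rule weighted_sum_superset[OF S(1)]) (simp add: S_def)
  also have "\<dots> = (\<Sum>a\<in>S. c a * w (\<kappa> a))"
  proof (rule sum.cong)
    fix a assume a: "a \<in> S"
    have "weighted_sum c (\<lambda>b. indicator E (u a, u b)) = weighted_sum c (\<lambda>b. indicator E (u b, u a))"
      by (simp add: indicator_def sym[of "u a"])
    then show "c a * weighted_sum c (\<lambda>b. indicator E (u a, u b)) = c a * w (\<kappa> a)"
      using ws[of "u a"] S(2) a by (simp add: \<kappa>_def)
  qed simp
  also have "\<dots> = (\<Sum>C\<in>\<kappa> ` S. \<Sum>a\<in>{a\<in>S. \<kappa> a = C}. c a * w (\<kappa> a))"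
    by (rule sum.image_gen[OF S(1)])
  also have "\<dots> = (\<Sum>C\<in>\<kappa> ` S. (w C)\<^sup>2)"
    by (rule sum.cong) (auto simp: w_def power2_eq_square sum_distrib_right)
  finally have *: "weighted_sum c (\<lambda>a. weighted_sum c (\<lambda>b. indicator E (u a, u b)))
      = (\<Sum>C\<in>\<kappa> ` S. (w C)\<^sup>2)" .
  show ?thesis
  proof (cases "E `` {y} \<in> \<kappa> ` S")
    case True
    then have "(w (E `` {y}))\<^sup>2 \<le> (\<Sum>C\<in>\<kappa> ` S. (w C)\<^sup>2)"
      by (intro member_le_sum) (use S(1) in auto)
    then show ?thesis using * ws[OF y] by simp
  next
    case False
    then have "{a\<in>S. \<kappa> a = E `` {y}} = {}" by auto
    then have "w (E `` {y}) = 0" unfolding w_def by (simp only: sum.empty)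
    then show ?thesis unfolding * ws[OF y] by (simp add: sum_nonneg)
  qed
qed

section \<open>A summability criterion\<close>

text \<open>
  By Markov's inequality \<open>\<bar>f n\<bar> \<ge> 1/2^n\<close> has probability at most \<open>C * (1/8)^n / (1/4)^n = C * (1/2)^n\<close>,
  so Borel and Cantelli leave only finitely many such \<open>n\<close> at almost every point, and the other terms
  are dominated by a geometric series.
\<close>

lemma (in prob_space) AE_summable_if_geometric_second_moments:
  fixes f :: "nat \<Rightarrow> 'a \<Rightarrow> real"
  assumes meas [measurable]: "\<And>n. f n \<in> borel_measurable M"
    and int: "\<And>n. integrable M (\<lambda>x. (f n x)\<^sup>2)"
    and bound: "\<And>n. (LINT x|M. (f n x)\<^sup>2) \<le> C * (1/8) ^ n"
  shows "AE x in M. summable (\<lambda>n. f n x)"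
proof -
  define B where "B n = {x \<in> space M. (1/4) ^ n \<le> (f n x)\<^sup>2}" for n
  have [measurable]: "B n \<in> sets M" for n unfolding B_def by measurable
  have le: "measure M (B n) \<le> C * (1/2) ^ n" for n
  proof -
    have "measure M (B n) \<le> (LINT x|M. (f n x)\<^sup>2) / (1/4) ^ n"
      unfolding B_def by (rule integral_Markov_inequality_measure[OF int, of "space M"]) auto
    also have "\<dots> \<le> (C * (1/8) ^ n) / (1/4) ^ n"
      by (rule divide_right_mono[OF bound]) simp
    also have "\<dots> = C * (1/2) ^ n"
    proof -
      have "(1/8 :: real) ^ n = (1/2) ^ n * (1/4) ^ n" by (simp flip: power_mult_distrib)
      then show ?thesis by simp
    qed
    finally show ?thesis .
  qed
  have "summable (\<lambda>n. measure M (B n))"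
    by (rule summable_comparison_test[of _ "\<lambda>n. C * (1/2) ^ n"])
      (use le in \<open>auto intro!: summable_mult summable_geometric\<close>)
  then have "AE x in M. eventually (\<lambda>n. x \<in> space M - B n) sequentially"
    by (intro borel_cantelli_AE1) (auto simp: emeasure_eq_measure)
  then show ?thesis
  proof (rule AE_mp, intro AE_I2 impI)
    fix x assume ev: "eventually (\<lambda>n. x \<in> space M - B n) sequentially"
    have "eventually (\<lambda>n. norm (f n x) \<le> (1/2) ^ n) sequentially"
      using ev
    proof (rule eventually_mono)
      fix n assume "x \<in> space M - B n"
      moreover have "((1/2 :: real) ^ n)\<^sup>2 = (1/4) ^ n"
        by (simp add: power2_eq_square flip: power_mult_distrib)
      ultimately have "\<bar>f n x\<bar>\<^sup>2 \<le> ((1/2) ^ n)\<^sup>2"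
        by (auto simp: B_def)
      then show "norm (f n x) \<le> (1/2) ^ n"
        unfolding real_norm_def by (rule power2_le_imp_le) simp
    qed
    then show "summable (\<lambda>n. f n x)"
      by (rule summable_comparison_test_ev) (auto intro!: summable_geometric)
  qed
qed

section \<open>The energy of a weight\<close>

locale pmp_subrelation = group \<Gamma> + prob_space M
  for \<Gamma> :: "('g, 'b) monoid_scheme" (structure) and M :: "'a measure" +
  fixes \<phi> :: "'g \<Rightarrow> 'a \<Rightarrow> 'a" and E :: "('a \<times> 'a) set"
  assumes action: "measure_preserving_action \<Gamma> M \<phi>" and rel: "borel_equiv M E"
begin

lemma equiv_E: "equiv (space M) E" and sets_E [measurable]: "E \<in> sets (M \<Otimes>\<^sub>M M)"
  using rel by (auto simp: borel_equiv_def)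

lemma measurable_action [measurable]: "g \<in> carrier \<Gamma> \<Longrightarrow> \<phi> g \<in> measurable M M"
  and distr_action: "g \<in> carrier \<Gamma> \<Longrightarrow> distr M M (\<phi> g) = M"
  and group_action: "group_action \<Gamma> (space M) \<phi>"
  using action by (auto simp: measure_preserving_action_def)

lemma action_in_space: "g \<in> carrier \<Gamma> \<Longrightarrow> x \<in> space M \<Longrightarrow> \<phi> g x \<in> space M"
  using group_action.element_image[OF group_action] by blast

lemma action_mult:
  "g \<in> carrier \<Gamma> \<Longrightarrow> h \<in> carrier \<Gamma> \<Longrightarrow> x \<in> space M \<Longrightarrow> \<phi> (g \<otimes> h) x = \<phi> g (\<phi> h x)"
  using group_action.composition_rule[OF group_action] by blast

lemma action_one: "x \<in> space M \<Longrightarrow> \<phi> \<one> x = x"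
  using group_action.id_eq_one[OF group_action] by (metis restrict_apply')

abbreviation FW where "FW \<equiv> fin_weights (carrier \<Gamma>)"
abbreviation PW where "PW \<equiv> prob_weights (carrier \<Gamma>)"

text \<open>
  The mass that the vector field of the weight \<open>c\<close> gives, at the base point \<open>x\<close>, to the class of \<open>y\<close>.
\<close>

definition class_weight :: "('g \<Rightarrow> real) \<Rightarrow> 'a \<Rightarrow> 'a \<Rightarrow> real" where
  "class_weight c x y = weighted_sum c (\<lambda>a. indicator E (\<phi> a x, y))"

definition kernel :: "'g \<Rightarrow> 'g \<Rightarrow> real" where
  "kernel a b = (LINT x|M. indicator E (\<phi> a x, \<phi> b x))"

definition energy :: "('g \<Rightarrow> real) \<Rightarrow> real" where
  "energy c = weighted_sum c (\<lambda>a. weighted_sum c (kernel a))"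

text \<open>
  The push-forward of \<open>c\<close> under right multiplication by \<open>g\<close>. Setting it to 0
  outside the carrier keeps its support inside the group.
\<close>

definition translate :: "'g \<Rightarrow> ('g \<Rightarrow> real) \<Rightarrow> 'g \<Rightarrow> real" where
  "translate g c a = (if a \<in> carrier \<Gamma> then c (a \<otimes> inv g) else 0)"

lemma PW_FW: "p \<in> PW \<Longrightarrow> p \<in> FW"
  by (simp add: prob_weights_def)

lemma FW_supp: "c \<in> FW \<Longrightarrow> c a \<noteq> 0 \<Longrightarrow> a \<in> carrier \<Gamma>"
  by (auto simp: fin_weights_def)

lemma integrable_pair [intro, simp]:
  assumes [measurable]: "a \<in> carrier \<Gamma>" "b \<in> carrier \<Gamma>"
  shows "integrable M (\<lambda>x. indicator E (\<phi> a x, \<phi> b x) :: real)"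
  by (rule integrable_const_bound[of _ 1]) (auto simp: indicator_def)

lemma translate_supp:
  assumes "g \<in> carrier \<Gamma>" "c \<in> FW"
  shows "{a. translate g c a \<noteq> 0} = (\<lambda>a. a \<otimes> g) ` {a. c a \<noteq> 0}"
proof (intro equalityI subsetI)
  fix a assume "a \<in> {a. translate g c a \<noteq> 0}"
  then have a: "a \<in> carrier \<Gamma>" "c (a \<otimes> inv g) \<noteq> 0" by (auto simp: translate_def split: if_splits)
  moreover have "a = (a \<otimes> inv g) \<otimes> g" using assms a by (simp add: m_assoc)
  ultimately show "a \<in> (\<lambda>a. a \<otimes> g) ` {a. c a \<noteq> 0}" by blast
next
  fix a assume "a \<in> (\<lambda>a. a \<otimes> g) ` {a. c a \<noteq> 0}"
  then show "a \<in> {a. translate g c a \<noteq> 0}"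
    using assms FW_supp[OF assms(2)] by (auto simp: translate_def m_assoc)
qed

lemma weighted_sum_translate:
  assumes g: "g \<in> carrier \<Gamma>" and c: "c \<in> FW"
  shows "weighted_sum (translate g c) f = weighted_sum c (\<lambda>a. f (a \<otimes> g))"
proof -
  have inj: "inj_on (\<lambda>a. a \<otimes> g) {a. c a \<noteq> 0}"
    using g FW_supp[OF c] by (auto simp: inj_on_def)
  show ?thesis
    unfolding weighted_sum_def translate_supp[OF assms] sum.reindex[OF inj] comp_def
    by (rule sum.cong) (use g FW_supp[OF c] in \<open>auto simp: translate_def m_assoc\<close>)
qed

lemma translate_FW: "g \<in> carrier \<Gamma> \<Longrightarrow> c \<in> FW \<Longrightarrow> translate g c \<in> FW"
  using translate_supp[of g c] by (auto simp: fin_weights_def)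

lemma translate_PW: "g \<in> carrier \<Gamma> \<Longrightarrow> p \<in> PW \<Longrightarrow> translate g p \<in> PW"
  using translate_FW[of g p] weighted_sum_translate[of g p "\<lambda>_. 1"]
  by (auto simp: prob_weights_def translate_def)

text \<open>
  Right translation of both arguments replaces \<open>x\<close> by \<open>\<phi> g x\<close> in the integral, which the invariance of
  the measure undoes. The invariance of the energy rests on this.
\<close>

lemma kernel_translate:
  assumes [measurable]: "a \<in> carrier \<Gamma>" "b \<in> carrier \<Gamma>" "g \<in> carrier \<Gamma>"
  shows "kernel (a \<otimes> g) (b \<otimes> g) = kernel a b"
proof -
  have "kernel a b = (LINT x|distr M M (\<phi> g). indicator E (\<phi> a x, \<phi> b x))"
    by (simp add: kernel_def distr_action assms)
  also have "\<dots> = (LINT x|M. indicator E (\<phi> a (\<phi> g x), \<phi> b (\<phi> g x)))"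
    by (rule integral_distr) measurable
  also have "\<dots> = kernel (a \<otimes> g) (b \<otimes> g)"
    unfolding kernel_def by (rule Bochner_Integration.integral_cong) (auto simp: action_mult assms)
  finally show ?thesis by simp
qed

lemma energy_translate:
  assumes g: "g \<in> carrier \<Gamma>" and c: "c \<in> FW"
  shows "energy (translate g c) = energy c"
  unfolding energy_def weighted_sum_translate[OF assms]
  by (intro weighted_sum_cong kernel_translate g FW_supp[OF c])

text \<open>
  The coefficients 1 and -1 are written out so that both combinations are instances of
  \<open>weighted_sum_lincomb_left\<close>; the same shape of difference is kept in everything that follows.
\<close>

lemma energy_parallelogram:
  assumes c: "c \<in> FW" and d: "d \<in> FW"
  shows "energy (\<lambda>a. 1 * c a + -1 * d a) + 4 * energy (\<lambda>a. 1/2 * c a + 1/2 * d a)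
    = 2 * energy c + 2 * energy d"
  unfolding energy_def weighted_sum_lincomb_left[OF c d] weighted_sum_lincomb_right
  by (simp add: field_simps)

lemma class_weight_measurable [measurable]:
  assumes c: "c \<in> FW" and [measurable]: "g \<in> carrier \<Gamma>"
  shows "(\<lambda>x. class_weight c x (\<phi> g x)) \<in> borel_measurable M"
  unfolding class_weight_def weighted_sum_def
  using c by (intro borel_measurable_sum borel_measurable_times) (auto simp: fin_weights_def)

lemma integrable_energy_density:
  assumes c: "c \<in> FW"
  shows "integrable M (\<lambda>x. weighted_sum c (\<lambda>a. weighted_sum c (\<lambda>b. indicator E (\<phi> a x, \<phi> b x))))"
  unfolding weighted_sum_def
  by (intro Bochner_Integration.integrable_sum integrable_mult_right integrable_pair)
    (use c in \<open>auto simp: fin_weights_def\<close>)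

lemma integral_energy_density:
  assumes c: "c \<in> FW"
  shows "(LINT x|M. weighted_sum c (\<lambda>a. weighted_sum c (\<lambda>b. indicator E (\<phi> a x, \<phi> b x)))) = energy c"
proof -
  have "energy c = (\<Sum>a | c a \<noteq> 0. c a * (LINT x|M. (\<Sum>b | c b \<noteq> 0. c b * indicator E (\<phi> a x, \<phi> b x))))"
    unfolding energy_def weighted_sum_def kernel_def
    by (intro sum.cong refl arg_cong2[where f = "(*)"], subst Bochner_Integration.integral_sum)
      (auto intro!: integrable_pair FW_supp[OF c])
  also have "\<dots> = (LINT x|M. (\<Sum>a | c a \<noteq> 0. c a * (\<Sum>b | c b \<noteq> 0. c b * indicator E (\<phi> a x, \<phi> b x))))"
    by (subst Bochner_Integration.integral_sum)
      (auto intro!: integrable_mult_right Bochner_Integration.integrable_sum integrable_pair FW_supp[OF c])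
  finally show ?thesis by (simp add: weighted_sum_def)
qed

lemma class_weight_square_le:
  assumes c: "c \<in> FW" and x: "x \<in> space M" and y: "y \<in> space M"
  shows "(class_weight c x y)\<^sup>2
    \<le> weighted_sum c (\<lambda>a. weighted_sum c (\<lambda>b. indicator E (\<phi> a x, \<phi> b x)))"
  unfolding class_weight_def
  by (rule square_class_weight_le[OF equiv_E c _ y]) (use x in \<open>auto intro: action_in_space\<close>)

lemma class_weight_second_moment:
  assumes c: "c \<in> FW" and g [measurable]: "g \<in> carrier \<Gamma>"
  shows "integrable M (\<lambda>x. (class_weight c x (\<phi> g x))\<^sup>2)"
    and "(LINT x|M. (class_weight c x (\<phi> g x))\<^sup>2) \<le> energy c"
proof -
  note [measurable] = class_weight_measurable[OF c g]
  show int: "integrable M (\<lambda>x. (class_weight c x (\<phi> g x))\<^sup>2)"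
  proof (rule Bochner_Integration.integrable_bound[OF integrable_energy_density[OF c]])
    show "AE x in M. norm ((class_weight c x (\<phi> g x))\<^sup>2)
      \<le> norm (weighted_sum c (\<lambda>a. weighted_sum c (\<lambda>b. indicator E (\<phi> a x, \<phi> b x))))"
      using class_weight_square_le[OF c] action_in_space[OF g] by (intro AE_I2) force
  qed measurable
  show "(LINT x|M. (class_weight c x (\<phi> g x))\<^sup>2) \<le> energy c"
    unfolding integral_energy_density[OF c, symmetric]
    by (rule integral_mono[OF int integrable_energy_density[OF c] class_weight_square_le[OF c]])
      (use action_in_space[OF g] in auto)
qed

lemma energy_nonneg: "c \<in> FW \<Longrightarrow> 0 \<le> energy c"
  by (rule order_trans[OF _ class_weight_second_moment(2)[OF _ one_closed]]) simp_all

lemma AE_summable_class_weight: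
  assumes "\<And>n. c n \<in> FW" "g \<in> carrier \<Gamma>" "\<And>n. energy (c n) \<le> C * (1/8) ^ n"
  shows "AE x in M. summable (\<lambda>n. class_weight (c n) x (\<phi> g x))"
proof (rule AE_summable_if_geometric_second_moments)
  fix n
  show "(\<lambda>x. class_weight (c n) x (\<phi> g x)) \<in> borel_measurable M"
    using assms(1,2) by (rule class_weight_measurable)
  show "integrable M (\<lambda>x. (class_weight (c n) x (\<phi> g x))\<^sup>2)"
    using assms(1,2) by (rule class_weight_second_moment(1))
  show "(LINT x|M. (class_weight (c n) x (\<phi> g x))\<^sup>2) \<le> C * (1/8) ^ n"
    using class_weight_second_moment(2)[OF assms(1,2)] assms(3) by (rule order_trans)
qed

text \<open>
  The midpoint of two probability weights is again one, so its energy is at least the infimum; the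
  parallelogram identity turns this into a bound on the difference.
\<close>

lemma near_minimisers_close:
  assumes d: "\<And>r. r \<in> PW \<Longrightarrow> d \<le> energy r"
    and p: "p \<in> PW" "energy p \<le> d + e" and q: "q \<in> PW" "energy q \<le> d + e"
  shows "energy (\<lambda>a. 1 * p a + -1 * q a) \<le> 4 * e"
  using energy_parallelogram[OF PW_FW[OF p(1)] PW_FW[OF q(1)]]
    d[OF prob_weights_midpoint[OF p(1) q(1)]] p(2) q(2) by linarith

lemma prob_weights_nonempty: "(\<lambda>a. if a = \<one> then 1 else 0) \<in> PW"
  by (auto simp: prob_weights_def fin_weights_def weighted_sum_def)

text \<open>
  A translate of a probability weight is a probability weight of the same energy. It is therefore as
  near to minimal as the original and must be close to it, with a bound that does not depend on
  the group element.
\<close>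

lemma ex_asymptotically_invariant_weights:
  obtains p where "\<And>n. p n \<in> PW"
    and "\<And>n. energy (\<lambda>a. 1 * p (Suc n) a + -1 * p n a) \<le> 4 * (1/8) ^ n"
    and "\<And>n g. g \<in> carrier \<Gamma> \<Longrightarrow> energy (\<lambda>a. 1 * p n a + -1 * translate g (p n) a) \<le> 4 * (1/8) ^ n"
proof -
  define d where "d = (INF r\<in>PW. energy r)"
  have bdd: "bdd_below (energy ` PW)" using energy_nonneg PW_FW by (intro bdd_belowI2[of _ 0]) auto
  have d: "d \<le> energy r" if "r \<in> PW" for r unfolding d_def using bdd that by (rule cINF_lower)
  have "\<exists>p\<in>PW. energy p < d + (1/8) ^ n" for n :: nat
    using cINF_less_iff[OF _ bdd, of "d + (1/8) ^ n"] prob_weights_nonempty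
    unfolding d_def by fastforce
  then obtain p where p: "\<And>n. p n \<in> PW" "\<And>n. energy (p n) < d + (1/8) ^ n" by metis
  show ?thesis
  proof (rule that)
    show "p n \<in> PW" for n by (rule p)
    show "energy (\<lambda>a. 1 * p (Suc n) a + -1 * p n a) \<le> 4 * (1/8) ^ n" for n
    proof (rule near_minimisers_close[OF d p(1) _ p(1)])
      have "(1/8 :: real) ^ Suc n \<le> (1/8) ^ n" by simp
      then show "energy (p (Suc n)) \<le> d + (1/8) ^ n" using p(2)[of "Suc n"] by linarith
      show "energy (p n) \<le> d + (1/8) ^ n" using p(2)[of n] by simp
    qed
    show "energy (\<lambda>a. 1 * p n a + -1 * translate g (p n) a) \<le> 4 * (1/8) ^ n" if g: "g \<in> carrier \<Gamma>" for n g
      using p(2)[of n] energy_translate[OF g PW_FW[OF p(1)]]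
      by (intro near_minimisers_close[OF d p(1) _ translate_PW[OF g p(1)]]) auto
  qed
qed

section \<open>The limiting mass of the class of a point\<close>

lemma class_weight_diff:
  assumes "c \<in> FW" "d \<in> FW"
  shows "class_weight (\<lambda>a. 1 * c a + -1 * d a) x y = class_weight c x y - class_weight d x y"
  unfolding class_weight_def weighted_sum_lincomb_left[OF assms] by simp

text \<open>
  Translating the weight moves the base point, so that a nearly
  invariant weight gives a class nearly the same mass from \<open>x\<close> and from \<open>\<phi> g x\<close>.
\<close>

lemma class_weight_translate:
  assumes "c \<in> FW" "g \<in> carrier \<Gamma>" "x \<in> space M"
  shows "class_weight (translate g c) x y = class_weight c (\<phi> g x) y"
  unfolding class_weight_def weighted_sum_translate[OF assms(2,1)]
  by (rule weighted_sum_cong) (use assms action_mult FW_supp in auto)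

lemma class_weight_bounds:
  assumes "p \<in> PW"
  shows "0 \<le> class_weight p x y" "class_weight p x y \<le> 1"
proof -
  show "0 \<le> class_weight p x y"
    using weighted_sum_mono[OF assms, of "\<lambda>_. 0" "\<lambda>a. indicator E (\<phi> a x, y)"]
    unfolding class_weight_def weighted_sum_const[OF assms] by simp
  show "class_weight p x y \<le> 1"
    using weighted_sum_mono[OF assms, of "\<lambda>a. indicator E (\<phi> a x, y)" "\<lambda>_. 1"]
    unfolding class_weight_def weighted_sum_const[OF assms] by (simp add: indicator_def)
qed

lemma class_weight_eq:
  assumes "(y, z) \<in> E"
  shows "class_weight c x y = class_weight c x z"
proof -
  have "indicator E (v, y) = (indicator E (v, z) :: real)" for v
    using equiv_E assms by (auto simp: indicator_def equiv_def elim: symE transE)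
  then show ?thesis by (simp add: class_weight_def)
qed

lemma class_weight_disjoint:
  assumes p: "p \<in> PW" and "(y, z) \<notin> E"
  shows "class_weight p x y + class_weight p x z \<le> 1"
proof -
  have "indicator E (v, y) + indicator E (v, z) \<le> (1::real)" for v
    using equiv_E assms(2) unfolding equiv_def by (auto simp: indicator_def elim: symE transE)
  then have "weighted_sum p (\<lambda>a. 1 * indicator E (\<phi> a x, y) + 1 * indicator E (\<phi> a x, z)) \<le> 1"
    using weighted_sum_mono[OF p, of _ "\<lambda>_. 1"] unfolding weighted_sum_const[OF p] by simp
  then show ?thesis unfolding weighted_sum_lincomb_right by (simp add: class_weight_def)
qed

lemma phi_rel_eq_integral:
  assumes [measurable]: "g \<in> carrier \<Gamma>"
  shows "phi_rel M \<phi> E g = (LINT x|M. indicator E (\<phi> g x, x))"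
proof -
  have "(LINT x|M. indicator E (\<phi> g x, x)) = (LINT x|M. indicator {x \<in> space M. (\<phi> g x, x) \<in> E} x)"
    by (rule Bochner_Integration.integral_cong) (auto simp: indicator_def)
  also have "\<dots> = phi_rel M \<phi> E g" unfolding phi_rel_def by simp
  finally show ?thesis by simp
qed

lemma own_class_weight_measurable:
  assumes p: "p \<in> FW"
  shows "(\<lambda>x. class_weight p x x) \<in> borel_measurable M"
  using class_weight_measurable[OF p one_closed]
  by (subst measurable_cong[of _ _ "\<lambda>x. class_weight p x (\<phi> \<one> x)"]) (auto simp: action_one)

lemma phi_rel_inf_le_integral:
  assumes p: "p \<in> PW"
  shows "phi_rel_inf \<Gamma> M \<phi> E \<le> (LINT x|M. class_weight p x x)"
proof -
  have bdd: "bdd_below (phi_rel M \<phi> E ` carrier \<Gamma>)"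
    by (rule bdd_belowI2[of _ 0]) (simp add: phi_rel_def)
  have int: "integrable M (\<lambda>x. indicator E (\<phi> a x, x) :: real)" if [measurable]: "a \<in> carrier \<Gamma>" for a
    by (rule integrable_const_bound[of _ 1]) (auto simp: indicator_def)
  have "phi_rel_inf \<Gamma> M \<phi> E \<le> weighted_sum p (phi_rel M \<phi> E)"
    using weighted_sum_mono[OF p, of "\<lambda>_. phi_rel_inf \<Gamma> M \<phi> E" "phi_rel M \<phi> E"] cINF_lower[OF bdd]
    unfolding weighted_sum_const[OF p] phi_rel_inf_def by blast
  also have "\<dots> = weighted_sum p (\<lambda>a. LINT x|M. indicator E (\<phi> a x, x))"
    by (rule weighted_sum_cong) (use FW_supp[OF PW_FW[OF p]] phi_rel_eq_integral in auto)
  also have "\<dots> = (LINT x|M. class_weight p x x)"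
    unfolding class_weight_def weighted_sum_def
    by (subst Bochner_Integration.integral_sum)
      (auto intro!: int integrable_mult_right FW_supp[OF PW_FW[OF p]])
  finally show ?thesis .
qed

text \<open>
  Outside one null set, the mass \<open>h n x\<close> of the class of \<open>x\<close> seen from \<open>x\<close> converges to \<open>f x\<close>, and the
  mass of the class of \<open>\<phi> g x\<close> seen from \<open>x\<close> differs from \<open>h n (\<phi> g x)\<close> by a null sequence; the
  countability of \<open>\<Gamma>\<close> allows one null set to serve all \<open>g\<close>. If \<open>x\<close> and \<open>y = \<phi> g x\<close> both avoid it, then
  \<open>f x\<close> and \<open>f y\<close> are the limits of the masses of their two classes seen from the single point \<open>x\<close>, so
  they are equal for equal classes and have sum at most 1 for distinct ones.
\<close>

lemma ex_limit_weight:
  assumes countable: "countable (carrier \<Gamma>)"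
  obtains f where "f \<in> borel_measurable M" "AE x in M. f x \<le> 1"
    "phi_rel_inf \<Gamma> M \<phi> E \<le> (LINT x|M. f x)" "integrable M f"
    "\<exists>N\<in>null_sets M. \<forall>x\<in>space M - N. \<forall>y\<in>space M - N. (x, y) \<in> orbit_rel \<Gamma> M \<phi> \<longrightarrow>
      ((x, y) \<in> E \<longrightarrow> f x = f y) \<and> ((x, y) \<notin> E \<longrightarrow> f x + f y \<le> 1)"
proof -
  obtain p where p: "\<And>n. p n \<in> PW"
    and step: "\<And>n. energy (\<lambda>a. 1 * p (Suc n) a + -1 * p n a) \<le> 4 * (1/8) ^ n"
    and inv: "\<And>n g. g \<in> carrier \<Gamma> \<Longrightarrow> energy (\<lambda>a. 1 * p n a + -1 * translate g (p n) a) \<le> 4 * (1/8) ^ n"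
    by (rule ex_asymptotically_invariant_weights, rule that)
  have pF: "p n \<in> FW" for n by (rule PW_FW[OF p])
  define h where "h n x = class_weight (p n) x x" for n x
  define f where "f x = lim (\<lambda>n. h n x)" for x
  have [measurable]: "h n \<in> borel_measurable M" for n
    unfolding h_def by (rule own_class_weight_measurable[OF pF])
  have fm [measurable]: "f \<in> borel_measurable M" unfolding f_def by measurable
  have h01: "0 \<le> h n x" "h n x \<le> 1" for n x unfolding h_def by (rule class_weight_bounds[OF p])+
  have "AE x in M. summable (\<lambda>n. class_weight (\<lambda>a. 1 * p (Suc n) a + -1 * p n a) x (\<phi> \<one> x))"
    by (rule AE_summable_class_weight[OF fin_weights_lincomb[OF pF pF] one_closed step])
  then have conv: "AE x in M. (\<lambda>n. h n x) \<longlonglongrightarrow> f x"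
  proof (rule AE_mp, intro AE_I2 impI)
    fix x assume x: "x \<in> space M"
      and "summable (\<lambda>n. class_weight (\<lambda>a. 1 * p (Suc n) a + -1 * p n a) x (\<phi> \<one> x))"
    then have "summable (\<lambda>n. h (Suc n) x - h n x)"
      by (simp only: class_weight_diff[OF pF pF] action_one h_def)
    then have "convergent (\<lambda>n. h n x - h 0 x)"
      unfolding summable_iff_convergent sum_lessThan_telescope[of "\<lambda>n. h n x"] .
    then have "convergent (\<lambda>n. h n x - h 0 x + h 0 x)" by (intro convergent_add convergent_const)
    then show "(\<lambda>n. h n x) \<longlonglongrightarrow> f x" unfolding f_def by (simp add: convergent_LIMSEQ_iff)
  qed
  have "AE x in M. \<forall>g\<in>carrier \<Gamma>. summable (\<lambda>n. class_weight (\<lambda>a. 1 * p n a + -1 * translate g (p n) a) x (\<phi> g x))"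
    by (subst AE_ball_countable[OF countable], intro ballI,
        rule AE_summable_class_weight[OF fin_weights_lincomb[OF pF translate_FW[OF _ pF]]])
      (use inv in auto)
  then have "AE x in M. \<forall>g\<in>carrier \<Gamma>. (\<lambda>n. class_weight (p n) x (\<phi> g x) - h n (\<phi> g x)) \<longlonglongrightarrow> 0"
  proof (rule AE_mp, intro AE_I2 impI ballI)
    fix x g assume x: "x \<in> space M" and g: "g \<in> carrier \<Gamma>"
      and "\<forall>g\<in>carrier \<Gamma>. summable (\<lambda>n. class_weight (\<lambda>a. 1 * p n a + -1 * translate g (p n) a) x (\<phi> g x))"
    then have "(\<lambda>n. class_weight (\<lambda>a. 1 * p n a + -1 * translate g (p n) a) x (\<phi> g x)) \<longlonglongrightarrow> 0"
      by (intro summable_LIMSEQ_zero) blast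
    then show "(\<lambda>n. class_weight (p n) x (\<phi> g x) - h n (\<phi> g x)) \<longlonglongrightarrow> 0"
      unfolding h_def by (simp only: class_weight_diff[OF pF translate_FW[OF g pF]] class_weight_translate[OF pF g x])
  qed
  with conv have "AE x in M. (\<lambda>n. h n x) \<longlonglongrightarrow> f x \<and>
      (\<forall>g\<in>carrier \<Gamma>. (\<lambda>n. class_weight (p n) x (\<phi> g x) - h n (\<phi> g x)) \<longlonglongrightarrow> 0)"
    by (rule AE_conjI)
  then obtain N where N: "N \<in> null_sets M" and good: "\<And>x. x \<in> space M - N \<Longrightarrow> (\<lambda>n. h n x) \<longlonglongrightarrow> f x"
    "\<And>x g. x \<in> space M - N \<Longrightarrow> g \<in> carrier \<Gamma> \<Longrightarrow>
      (\<lambda>n. class_weight (p n) x (\<phi> g x) - h n (\<phi> g x)) \<longlonglongrightarrow> 0"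
    by (elim AE_E3) blast
  show ?thesis
  proof (rule that[OF fm])
    show "AE x in M. f x \<le> 1" using conv
    proof (rule AE_mp, intro AE_I2 impI)
      fix x assume "(\<lambda>n. h n x) \<longlonglongrightarrow> f x"
      then show "f x \<le> 1" by (rule LIMSEQ_le_const2) (use h01 in auto)
    qed
    have dom: "AE x in M. norm (h n x) \<le> 1" for n using h01 by (intro AE_I2) simp
    have lim: "(\<lambda>n. LINT x|M. h n x) \<longlonglongrightarrow> (LINT x|M. f x)"
      by (rule integral_dominated_convergence[OF _ _ _ conv dom]) auto
    show "phi_rel_inf \<Gamma> M \<phi> E \<le> (LINT x|M. f x)"
      by (rule LIMSEQ_le_const[OF lim]) (use phi_rel_inf_le_integral[OF p] in \<open>auto simp: h_def\<close>)
    show "integrable M f"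
      by (rule integrable_dominated_convergence[OF _ _ _ conv dom]) auto
    show "\<exists>N\<in>null_sets M. \<forall>x\<in>space M - N. \<forall>y\<in>space M - N. (x, y) \<in> orbit_rel \<Gamma> M \<phi> \<longrightarrow>
      ((x, y) \<in> E \<longrightarrow> f x = f y) \<and> ((x, y) \<notin> E \<longrightarrow> f x + f y \<le> 1)"
    proof (intro bexI[OF _ N] ballI impI)
      fix x y assume x: "x \<in> space M - N" and y: "y \<in> space M - N" and "(x, y) \<in> orbit_rel \<Gamma> M \<phi>"
      then obtain g where g: "g \<in> carrier \<Gamma>" and yg: "y = \<phi> g x"
        unfolding orbit_rel_def orbit_def by auto
      have "(\<lambda>n. (class_weight (p n) x y - h n y) + h n y) \<longlonglongrightarrow> 0 + f y"
        using good(2)[OF x g] good(1)[OF y] unfolding yg by (rule tendsto_add)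
      then have y_lim: "(\<lambda>n. class_weight (p n) x y) \<longlonglongrightarrow> f y" by simp
      have x_lim: "(\<lambda>n. class_weight (p n) x x) \<longlonglongrightarrow> f x" using good(1)[OF x] by (simp add: h_def)
      show "((x, y) \<in> E \<longrightarrow> f x = f y) \<and> ((x, y) \<notin> E \<longrightarrow> f x + f y \<le> 1)"
      proof (intro conjI impI)
        assume "(x, y) \<in> E"
        then show "f x = f y"
          using x_lim y_lim class_weight_eq LIMSEQ_unique by simp
      next
        assume "(x, y) \<notin> E"
        then show "f x + f y \<le> 1"
          by (intro LIMSEQ_le_const2[OF tendsto_add[OF x_lim y_lim]])
            (use class_weight_disjoint[OF p] in auto)
      qed
    qed
  qed
qed

end

theorem corollary2p15:
  fixes \<Gamma> :: "('g, 'b) monoid_scheme"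
    and M :: "'a measure"
    and \<phi> :: "'g \<Rightarrow> 'a \<Rightarrow> 'a"
    and E F :: "('a \<times> 'a) set"
  assumes "group \<Gamma>" and "countable (carrier \<Gamma>)"
    and "standard_prob_space M"
    and "measure_preserving_action \<Gamma> M \<phi>" and "ergodic_action \<Gamma> M \<phi>"
    and "F = orbit_rel \<Gamma> M \<phi>"
    and "borel_equiv M E" and "ae_subrel M E F"
    and "phi_rel_inf \<Gamma> M \<phi> E > 3 / 4"
  shows "\<exists>A\<in>sets M. ae_invariant M E A \<and>
           ae_eq_rel M (rel_restrict E A) (rel_restrict F A) \<and>
           measure M A \<ge> 4 * phi_rel_inf \<Gamma> M \<phi> E - 3"
proof -
  have ps: "prob_space M" using assms(3) by (simp add: standard_prob_space_def)
  interpret pmp_subrelation \<Gamma> M \<phi> E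
    by (rule pmp_subrelation.intro[OF assms(1) ps pmp_subrelation_axioms.intro[OF assms(4,7)]])
  obtain f where f [measurable]: "f \<in> borel_measurable M" and f_le: "AE x in M. f x \<le> 1"
    and f_int: "phi_rel_inf \<Gamma> M \<phi> E \<le> (LINT x|M. f x)" "integrable M f"
    and null: "\<exists>N\<in>null_sets M. \<forall>x\<in>space M - N. \<forall>y\<in>space M - N. (x, y) \<in> F \<longrightarrow>
      ((x, y) \<in> E \<longrightarrow> f x = f y) \<and> ((x, y) \<notin> E \<longrightarrow> f x + f y \<le> 1)"
    unfolding assms(6) by (rule ex_limit_weight[OF assms(2)])
  obtain N\<^sub>1 where N1: "N\<^sub>1 \<in> null_sets M"
    and f_eq: "\<And>x y. x \<in> space M - N\<^sub>1 \<Longrightarrow> y \<in> space M - N\<^sub>1 \<Longrightarrow> (x, y) \<in> F \<Longrightarrow> (x, y) \<in> E \<Longrightarrow> f x = f y"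
    and f_disj: "\<And>x y. x \<in> space M - N\<^sub>1 \<Longrightarrow> y \<in> space M - N\<^sub>1 \<Longrightarrow> (x, y) \<in> F \<Longrightarrow> (x, y) \<notin> E \<Longrightarrow> f x + f y \<le> 1"
    using null by blast
  obtain N\<^sub>2 where N2: "N\<^sub>2 \<in> null_sets M"
    and sub: "\<And>x y. x \<in> space M - N\<^sub>2 \<Longrightarrow> y \<in> space M - N\<^sub>2 \<Longrightarrow> (x, y) \<in> E \<Longrightarrow> (x, y) \<in> F"
    using assms(8) unfolding ae_subrel_def by blast
  have N: "N\<^sub>1 \<union> N\<^sub>2 \<in> null_sets M" using N1 N2 by (rule null_sets.Un)
  \<comment> \<open>Two classes of one orbit cannot both carry a mass above one half.\<close>
  define A where "A = {x \<in> space M. 1/2 < f x}"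
  have A [measurable]: "A \<in> sets M" unfolding A_def by measurable
  have "ae_invariant M E A"
    unfolding ae_invariant_def
    by (rule bexI[OF _ N]) (use sub f_eq in \<open>force simp: A_def\<close>)
  moreover have "ae_eq_rel M (rel_restrict E A) (rel_restrict F A)"
    unfolding ae_eq_rel_def
  proof (rule bexI[OF _ N], intro ballI)
    fix x y assume x: "x \<in> space M - (N\<^sub>1 \<union> N\<^sub>2)" and y: "y \<in> space M - (N\<^sub>1 \<union> N\<^sub>2)"
    have "(x, y) \<in> E" if "(x, y) \<in> F" "x \<in> A" "y \<in> A"
      using f_disj[of x y] x y that by (force simp: A_def)
    then show "(x, y) \<in> rel_restrict E A \<longleftrightarrow> (x, y) \<in> rel_restrict F A"
      using sub[of x y] x y by (auto simp: rel_restrict_def)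
  qed
  moreover have "4 * phi_rel_inf \<Gamma> M \<phi> E - 3 \<le> measure M A"
  proof -
    have int_A: "integrable M (\<lambda>x. 1/2 * indicator A x :: real)"
      by (rule integrable_const_bound[of _ 1]) (auto simp: indicator_def)
    have "(LINT x|M. f x) \<le> (LINT x|M. 1/2 + 1/2 * indicator A x)"
    proof (rule integral_mono_AE[OF f_int(2)])
      show "AE x in M. f x \<le> 1/2 + 1/2 * indicator A x"
        using f_le by (rule AE_mp) (auto intro!: AE_I2 simp: A_def indicator_def)
      show "integrable M (\<lambda>x. 1/2 + 1/2 * indicator A x :: real)"
        using int_A by (intro Bochner_Integration.integrable_add integrable_const)
    qed
    also have "\<dots> = 1/2 + 1/2 * measure M A"
      by (subst Bochner_Integration.integral_add[OF _ int_A]) (simp_all add: prob_space)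
    finally have "2 * phi_rel_inf \<Gamma> M \<phi> E - 1 \<le> measure M A" using f_int(1) by linarith
    moreover have "measure M A \<le> 1" by (rule prob_le_1)
    ultimately show ?thesis by linarith
  qed
  ultimately show ?thesis using A by blast
qed

end
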